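(* Let $\Gamma$ be a finite directed graph containing an edge $a$ that is a directed circuit of length one, let $m\geq 1$, and let $L=L_{a^m,d}$ be a closed inverse subsemigroup of cycle type of the graph inverse semigroup $\mathcal{S}(\Gamma)$. (a) $L$ is of infinite index in $\mathcal{S}(\Gamma)$ if there exist a directed cycle $c$ in $\Gamma$ that contains an edge $e$ with $a\neq e$, and a (possibly empty) directed path $g$ from some vertex $v_0$ of $d$ to a vertex of $c$, with $g$ having no edge in common with $c\cup d$. (b) Suppose that there are no other directed circuits in $\Gamma$ attached to a vertex of $d$; that is, there do not exist a directed circuit $c$ in $\Gamma$ containing an edge $e\neq a$ and a (possibly empty) directed path $g$ from some vertex of $d$ to a vertex of $c$, with $g$ having no edge in common with $c\cup d$. Then $L$ has finite index in $\mathcal{S}(\Gamma)$, given by $$[\mathcal{S}(\Gamma):L_{a^m,d}]=(m-1)\,N^{\Gamma}_{\mathbf{d}(a),a}+\sum_{v\in V(d)}N^{\Gamma\setminus\{a\}}_{v,d}.$$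
   Context: Paths: a path in a directed graph $\Gamma$ is a directed path; a single vertex is allowed as an empty (length zero) path. $\mathbf{d}(v)$ and $\mathbf{r}(v)$ denote the initial and terminal vertices of a path $v$. Paths are composed left to right: $pv$ is $p$ followed by $v$, defined when $\mathbf{r}(p)=\mathbf{d}(v)$. A path $v$ is a suffix of $u$ if $u=pv$ for some (possibly empty) path $p$, and a prefix of $u$ if $u=vp$ for some (possibly empty) path $p$. A directed circuit (or directed cycle) is a path of positive length whose initial and terminal vertices coincide; $p^0$ is the empty path at $\mathbf{d}(p)$. $V(w)$ is the set of vertices of the path $w$. Graph inverse semigroup: $\mathcal{S}(\Gamma)$ has underlying set $\{(v,w): v,w \text{ paths in } \Gamma,\ \mathbf{d}(v)=\mathbf{d}(w)\}\cup\{0\}$, where $0$ is a zero element, with product $$(t,u)(v,w)=\begin{cases}(t,pw) & \text{if } u=pv \text{ for a path } p,\\ (pt,w) & \text{if } v=pu \text{ for a path } p,\\ 0 & \text{otherwise.}\end{cases}$$ It is an inverse semigroup with $(v,w)^{-1}=(w,v)$. Its idempotents are $0$ and the elements $(u,u)$. Order, closure, index: in an inverse semigroup $S$ the natural partial order is $s\leq t$ iff $s=et$ for some idempotent $e$. A subset $A\subseteq S$ is closed if $a\in A$ and $a\leq s$ imply $s\in A$. An inverse subsemigroup is a non-empty subset closed under products and inverses. For a closed inverse subsemigroup $L$ of $S$, a (right) coset of $L$ is a set $(Lt)^{\uparrow}=\{s\in S: s\geq xt \text{ for some } x\in L\}$ where $t\in S$ satisfies $tt^{-1}\in L$. The index $[S:L]$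 is the cardinality of the set of cosets of $L$ in $S$ (the cosets need not cover $S$). Cycle type: for a directed circuit $p$ in $\Gamma$ and a path $d$ starting at the initial vertex of $p$ such that $p,d$ do not share a prefix of positive length, the closed inverse subsemigroup $L_{p,d}$ of $\mathcal{S}(\Gamma)$ is $$L_{p,d}=\{(vp^rd,\,vp^sd): r,s\geq 0,\ v \text{ a suffix of } p\}\cup\{(q,q): q \text{ a suffix of } d\}.$$ Here $p=a^m$, so $d$ is a (possibly empty) path with initial vertex $\mathbf{d}(a)$ whose first edge, if any, is not $a$. For a directed graph $\Delta$, a path $w$ and a vertex $v$ of $w$, $N^{\Delta}_{v,w}$ is the number of distinct directed paths in $\Delta$ whose initial vertex is $v$ but whose first edge is not in $w$; the empty path $v$ is counted as one such path. $\Gamma\setminus\{a\}$ is the graph obtained from $\Gamma$ by deleting the edge $a$ (keeping all vertices). *)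

theory Defs
  imports
    "Graph_Theory.Arc_Walk"
    "HOL-Algebra.Congruence"
    "HOL-Library.Extended_Nat"
begin

text \<open>Infinite sets get \<^term>\<open>\<infinity>\<close>, whereas \<^const>\<open>card\<close> would give 0.\<close>

definition ecard :: "'a set \<Rightarrow> enat" where
  "ecard A = (if finite A then enat (card A) else \<infinity>)"

record 'a mult_structure = "'a partial_object" +
  smult :: "'a \<Rightarrow> 'a \<Rightarrow> 'a" (infixl \<open>\<odot>\<index>\<close> 70)

definition sinv :: "('a, 'm) mult_structure_scheme \<Rightarrow> 'a \<Rightarrow> 'a" where
  "sinv S x = (THE y. y \<in> carrier S \<and> x \<odot>\<^bsub>S\<^esub> y \<odot>\<^bsub>S\<^esub> x = x \<and> y \<odot>\<^bsub>S\<^esub> x \<odot>\<^bsub>S\<^esub> y = y)"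

definition idempotents :: "('a, 'm) mult_structure_scheme \<Rightarrow> 'a set" where
  "idempotents S = {e \<in> carrier S. e \<odot>\<^bsub>S\<^esub> e = e}"

definition nat_le :: "('a, 'm) mult_structure_scheme \<Rightarrow> 'a \<Rightarrow> 'a \<Rightarrow> bool" where
  "nat_le S s t \<longleftrightarrow> s \<in> carrier S \<and> t \<in> carrier S \<and> (\<exists>e\<in>idempotents S. s = e \<odot>\<^bsub>S\<^esub> t)"

definition coset_of :: "('a, 'm) mult_structure_scheme \<Rightarrow> 'a set \<Rightarrow> 'a \<Rightarrow> 'a set" where
  "coset_of S L t = {s \<in> carrier S. \<exists>x\<in>L. nat_le S (x \<odot>\<^bsub>S\<^esub> t) s}"

definition cosets :: "('a, 'm) mult_structure_scheme \<Rightarrow> 'a set \<Rightarrow> 'a set set" where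
  "cosets S L = {coset_of S L t | t. t \<in> carrier S \<and> t \<odot>\<^bsub>S\<^esub> sinv S t \<in> L}"

definition sindex :: "('a, 'm) mult_structure_scheme \<Rightarrow> 'a set \<Rightarrow> enat" where
  "sindex S L = ecard (cosets S L)"

text \<open>A path is its initial vertex together with its list of arcs, so that empty paths at
  different vertices are different. The arcs of the digraph may have parallels and loops.\<close>

type_synonym ('a, 'b) dpath = "'a \<times> 'b list"

definition paths :: "('a, 'b) pre_digraph \<Rightarrow> ('a, 'b) dpath set" where
  "paths G = {p. \<exists>v. pre_digraph.awalk G (fst p) (snd p) v}"

abbreviation pdom :: "('a, 'b) dpath \<Rightarrow> 'a" where
  "pdom p \<equiv> fst p"

definition pran :: "('a, 'b) pre_digraph \<Rightarrow> ('a, 'b) dpath \<Rightarrow> 'a" where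
  "pran G p = pre_digraph.awlast G (fst p) (snd p)"

abbreviation pedges :: "('a, 'b) dpath \<Rightarrow> 'b set" where
  "pedges p \<equiv> set (snd p)"

definition path_verts :: "('a, 'b) pre_digraph \<Rightarrow> ('a, 'b) dpath \<Rightarrow> 'a set" where
  "path_verts G p = set (pre_digraph.awalk_verts G (fst p) (snd p))"

text \<open>Only meaningful when \<^term>\<open>pran G p = pdom v\<close>.\<close>

definition papp :: "('a, 'b) dpath \<Rightarrow> ('a, 'b) dpath \<Rightarrow> ('a, 'b) dpath" (infixr \<open>\<bullet>\<close> 75) where
  "p \<bullet> v = (fst p, snd p @ snd v)"

definition ppow :: "('a, 'b) dpath \<Rightarrow> nat \<Rightarrow> ('a, 'b) dpath" where
  "ppow p n = (fst p, concat (replicate n (snd p)))"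

definition is_decomp ::
  "('a, 'b) pre_digraph \<Rightarrow> ('a, 'b) dpath \<Rightarrow> ('a, 'b) dpath \<Rightarrow> ('a, 'b) dpath \<Rightarrow> bool" where
  "is_decomp G u p v \<longleftrightarrow> p \<in> paths G \<and> v \<in> paths G \<and> pran G p = pdom v \<and> u = p \<bullet> v"

definition psuffix :: "('a, 'b) pre_digraph \<Rightarrow> ('a, 'b) dpath \<Rightarrow> ('a, 'b) dpath \<Rightarrow> bool" where
  "psuffix G v u \<longleftrightarrow> (\<exists>p. is_decomp G u p v)"

definition pprefix :: "('a, 'b) pre_digraph \<Rightarrow> ('a, 'b) dpath \<Rightarrow> ('a, 'b) dpath \<Rightarrow> bool" where
  "pprefix G v u \<longleftrightarrow> (\<exists>p. is_decomp G u v p)"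

definition is_circuit :: "('a, 'b) pre_digraph \<Rightarrow> ('a, 'b) dpath \<Rightarrow> bool" where
  "is_circuit G p \<longleftrightarrow> p \<in> paths G \<and> snd p \<noteq> [] \<and> pdom p = pran G p"

definition arc_path :: "('a, 'b) pre_digraph \<Rightarrow> 'b \<Rightarrow> ('a, 'b) dpath" where
  "arc_path G a = (tail G a, [a])"

datatype ('a, 'b) gis = Zero | Elem "('a, 'b) dpath" "('a, 'b) dpath"

text \<open>In a decomposition \<^term>\<open>is_decomp G u p v\<close> the path \<^term>\<open>p\<close> is determined by
  \<^term>\<open>u\<close> and \<^term>\<open>v\<close>, which makes the definite descriptions below well-defined.\<close>

fun gis_mult ::
  "('a, 'b) pre_digraph \<Rightarrow> ('a, 'b) gis \<Rightarrow> ('a, 'b) gis \<Rightarrow> ('a, 'b) gis" where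
  "gis_mult G (Elem t u) (Elem v w) =
     (if \<exists>p. is_decomp G u p v then Elem t ((THE p. is_decomp G u p v) \<bullet> w)
      else if \<exists>p. is_decomp G v p u then Elem ((THE p. is_decomp G v p u) \<bullet> t) w
      else Zero)"
| "gis_mult G _ _ = Zero"

definition graph_inverse_semigroup ::
  "('a, 'b) pre_digraph \<Rightarrow> ('a, 'b) gis mult_structure" (\<open>\<S>\<close>) where
  "\<S> G = \<lparr> carrier = {Elem v w | v w. v \<in> paths G \<and> w \<in> paths G \<and> pdom v = pdom w} \<union> {Zero},
           smult = gis_mult G \<rparr>"

definition cycle_type_pair ::
  "('a, 'b) pre_digraph \<Rightarrow> ('a, 'b) dpath \<Rightarrow> ('a, 'b) dpath \<Rightarrow> bool" where
  "cycle_type_pair G p d \<longleftrightarrow>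
     is_circuit G p \<and> d \<in> paths G \<and> pdom d = pdom p \<and>
     \<not> (\<exists>x. snd x \<noteq> [] \<and> pprefix G x p \<and> pprefix G x d)"

definition cycle_type ::
  "('a, 'b) pre_digraph \<Rightarrow> ('a, 'b) dpath \<Rightarrow> ('a, 'b) dpath \<Rightarrow> ('a, 'b) gis set" where
  "cycle_type G p d =
     {Elem (v \<bullet> ppow p r \<bullet> d) (v \<bullet> ppow p s \<bullet> d) | v r s. psuffix G v p} \<union>
     {Elem q q | q. psuffix G q d}"

definition num_paths :: "('a, 'b) pre_digraph \<Rightarrow> 'a \<Rightarrow> ('a, 'b) dpath \<Rightarrow> enat" where
  "num_paths D v w =
     ecard {x \<in> paths D. pdom x = v \<and> (snd x = [] \<or> hd (snd x) \<notin> pedges w)}"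

definition other_circuit_attached ::
  "('a, 'b) pre_digraph \<Rightarrow> 'b \<Rightarrow> ('a, 'b) dpath \<Rightarrow> bool" where
  "other_circuit_attached G a d \<longleftrightarrow>
     (\<exists>c e g. is_circuit G c \<and> e \<in> pedges c \<and> a \<noteq> e \<and>
        g \<in> paths G \<and> pdom g \<in> path_verts G d \<and> pran G g \<in> path_verts G c \<and>
        pedges g \<inter> (pedges c \<union> pedges d) = {})"

end

theory Submission
  imports Defs
begin

text \<open>
  Put \<open>l = length d\<close>. The first components of the elements of \<open>L\<close> are the suffixes of the left-infinite
  word \<open>\<dots>aaad\<close>; let \<open>s n\<close> be the one of length \<open>n\<close>. Then \<open>L\<close> consists of the pairs \<open>(s i, s j)\<close>
  with \<open>i = j\<close>, or \<open>i, j \<ge> l\<close> and \<open>i \<equiv> j\<close> modulo \<open>m\<close>. A coset is represented by a pair \<open>(s n, w)\<close>,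
  and \<open>(s n, w)\<close>, \<open>(s k, z)\<close> represent the same coset iff they become equal up to \<open>L\<close> after common left
  extension: \<open>(p (s n), q (s k)) \<in> L\<close> and \<open>p w = q z\<close> for some paths \<open>p, q\<close>. Cancelling common first
  edges, and replacing \<open>n \<ge> l\<close> by its residue, gives a unique normal form, with \<open>n < l + m\<close> and the
  first edge of \<open>w\<close> different from that of \<open>s n\<close>, and from \<open>a\<close> if \<open>n \<ge> l\<close>.

  A circuit \<open>c\<close> with an edge other than \<open>a\<close>, reachable from \<open>d\<close> along \<open>g\<close>, gives the pairs
  \<open>(s n, g c\<^sup>i)\<close>, which are inequivalent because, for fixed \<open>n\<close>, the number of edges other than \<open>a\<close> in \<open>w\<close>
  depends only on the coset of \<open>(s n, w)\<close>. Without such circuits \<open>d\<close> visits no vertex twice and the walks counted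
  avoid \<open>a\<close> and repeated vertices, so the normal forms are finitely many: those with \<open>n \<le> l\<close> give the
  sum over the vertices of \<open>d\<close>, the remaining \<open>m - 1\<close> values of \<open>n\<close> give the first summand.
\<close>

section \<open>Words with a periodic left end\<close>

lemma mod_add_right_cancel_nat:
  fixes k h e m :: nat
  assumes "(k + e) mod m = (h + e) mod m"
  shows "k mod m = h mod m"
proof -
  obtain q r where "k + e + m * q = h + e + m * r"
    using assms nat_mod_eq_iff by blast
  then have "k + m * q = h + m * r"
    by simp
  then show ?thesis
    using nat_mod_eq_iff by blast
qed

locale cycle_word =
  fixes a :: 'b and m :: nat and d :: "'b list"
  assumes m_pos: "m \<ge> 1"
    and hd_ne: "d \<noteq> [] \<Longrightarrow> hd d \<noteq> a"
begin

text \<open>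
  \<open>suff n\<close> is \<open>s n\<close>; the truncated subtractions make one formula cover \<open>n \<le> length d\<close> and
  \<open>n \<ge> length d\<close>. A pair \<open>(n, w)\<close> stands for the element \<open>(s n, w)\<close> of the semigroup.
\<close>

definition suff :: "nat \<Rightarrow> 'b list" where
  "suff n = replicate (n - length d) a @ drop (length d - n) d"

text \<open>Encodes that the pair of suffixes of lengths \<open>i\<close> and \<open>j\<close> lies
  in \<open>L\<close>; see \<open>cycle_type_eq_subsemi\<close>.\<close>

definition cong :: "nat \<Rightarrow> nat \<Rightarrow> bool" where
  "cong i j \<longleftrightarrow> i = j \<or> length d \<le> i \<and> length d \<le> j \<and> i mod m = j mod m"

text \<open>For \<open>k \<le> i\<close> this is the word that extends \<open>suff k\<close> on the
  left to \<open>suff i\<close>.\<close>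

definition seg :: "nat \<Rightarrow> nat \<Rightarrow> 'b list" where
  "seg k i = take (i - k) (suff i)"

text \<open>Here \<open>j\<close> is the length to which the first pair is extended and
  \<open>i\<close> the length for the second. This order matches the product of
  \<open>(suff i, suff j)\<close> with the first pair.\<close>

definition rel :: "nat \<times> 'b list \<Rightarrow> nat \<times> 'b list \<Rightarrow> bool" where
  "rel s t \<longleftrightarrow> (\<exists>i j. fst s \<le> j \<and> fst t \<le> i \<and> cong i j \<and>
     seg (fst t) i @ snd t = seg (fst s) j @ snd s)"

text \<open>The first letters of \<open>w\<close> that can be cancelled: the one shared with
  \<open>suff n\<close> and, from \<open>length d\<close> on, also \<open>a\<close>, because
  \<open>suff n\<close> may be traded for a congruent longer suffix, which begins with
  \<open>a\<close>.\<close>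

definition forb :: "nat \<Rightarrow> 'b set" where
  "forb n = (if n = 0 then {} else {hd (suff n)}) \<union> (if length d \<le> n then {a} else {})"

definition normal :: "nat \<Rightarrow> 'b list \<Rightarrow> bool" where
  "normal n w \<longleftrightarrow> n < length d + m \<and> (w = [] \<or> hd w \<notin> forb n)"

section \<open>Suffixes, segments and congruence of lengths\<close>

lemma length_suff [simp]: "length (suff n) = n"
  by (simp add: suff_def)

lemma suff_eq_iff [simp]: "suff i = suff j \<longleftrightarrow> i = j"
  by (metis length_suff)

lemma suff_eq_drop: "n \<le> length d \<Longrightarrow> suff n = drop (length d - n) d"
  by (simp add: suff_def)

lemma suff_ge: "length d \<le> n \<Longrightarrow> suff n = replicate (n - length d) a @ d"
  by (simp add: suff_def)

lemma drop_suff: "k \<le> i \<Longrightarrow> drop (i - k) (suff i) = suff k"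
  by (cases "length d \<le> i"; cases "length d \<le> k") (auto simp: suff_def)

lemma seg_append_suff: "k \<le> i \<Longrightarrow> seg k i @ suff k = suff i"
  by (metis append_take_drop_id drop_suff seg_def)

lemma length_seg [simp]: "length (seg k i) = i - k"
  by (simp add: seg_def)

lemma seg_self [simp]: "seg k k = []"
  by (simp add: seg_def)

lemma seg_append_seg: "k \<le> j \<Longrightarrow> j \<le> i \<Longrightarrow> seg j i @ seg k j = seg k i"
  using seg_append_suff[of j i] seg_append_suff[of k j] seg_append_suff[of k i]
  by (metis append.assoc append_same_eq le_trans)

lemma seg_ge: "length d \<le> k \<Longrightarrow> seg k i = replicate (i - k) a"
  by (cases "k \<le> i") (auto simp: seg_def suff_def min_def)

lemma seg_le_ge:
  "k \<le> length d \<Longrightarrow> length d \<le> i \<Longrightarrow>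
    seg k i = replicate (i - length d) a @ take (length d - k) d"
  by (auto simp: seg_def suff_def min_def)

lemma seg_Suc: "seg n (Suc n) = [hd (suff (Suc n))]"
  by (simp add: seg_def take_Suc) (metis Zero_not_Suc length_0_conv length_suff take_Suc take_0)

lemma hd_suff: "length d < n \<Longrightarrow> hd (suff n) = a"
  by (simp add: suff_def)

lemma hd_seg: "k < i \<Longrightarrow> hd (seg k i) = hd (suff i)"
  by (simp add: seg_def hd_take)

lemma cong_refl [simp]: "cong i i"
  by (simp add: cong_def)

lemma cong_sym: "cong i j \<Longrightarrow> cong j i"
  by (auto simp: cong_def)

lemma cong_trans [trans]: "cong i j \<Longrightarrow> cong j k \<Longrightarrow> cong i k"
  by (auto simp: cong_def)

text \<open>The lengths from \<open>length d\<close> to \<open>length d + m - 1\<close> form one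
  complete residue system modulo \<open>m\<close>; if either length is below
  \<open>length d\<close>, congruence is equality.\<close>

lemma cong_less_imp_eq:
  assumes "cong p q" "p < length d + m" "q < length d + m"
  shows "p = q"
proof (rule ccontr)
  assume ne: "p \<noteq> q"
  then have "length d \<le> p" "length d \<le> q" and md: "p mod m = q mod m"
    using assms(1) by (auto simp: cong_def)
  then have "q - p < m" "p - q < m"
    using assms(2,3) by linarith+
  moreover have "p \<le> q \<Longrightarrow> m dvd q - p" "q \<le> p \<Longrightarrow> m dvd p - q"
    using md by (simp_all add: mod_eq_dvd_iff_nat[symmetric])
  ultimately show False
    using ne by (metis nat_dvd_not_less linorder_neqE_nat nat_less_le zero_less_diff)
qed

lemma cong_add: "cong i j \<Longrightarrow> cong (i + e) (j + e)"
  by (auto simp: cong_def intro: mod_add_cong)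

text \<open>Distinct congruent lengths are both at least \<open>length d\<close>, where every
  segment is a power of \<open>a\<close>.\<close>

lemma seg_cong: "cong i j \<Longrightarrow> seg i (i + e) = seg j (j + e)"
  by (auto simp: cong_def seg_ge)

text \<open>Congruence alone does not survive shortening, since a length may drop below
  \<open>length d\<close>. The equal segments exclude this: the number of their leading
  \<open>a\<close>'s shows where \<open>d\<close> begins.\<close>

lemma cong_cancel_seg:
  assumes "cong (k + e) (h + e)" and eq: "seg k (k + e) = seg h (h + e)"
  shows "cong k h"
proof (cases "k = h")
  case False
  then have ge: "length d \<le> k + e" "length d \<le> h + e" and md: "(k + e) mod m = (h + e) mod m"
    using assms(1) by (auto simp: cong_def)
  \<comment> \<open>As \<open>d\<close> does not begin with \<open>a\<close>, the leading run of
    \<open>a\<close>'s stops exactly at the start of \<open>d\<close>.\<close>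
  have tw: "length (takeWhile (\<lambda>x. x = a) (seg i (i + e))) =
      (if length d \<le> i then e else i + e - length d)" if "length d \<le> i + e" for i
  proof (cases "length d \<le> i")
    case True
    then show ?thesis by (simp add: seg_ge takeWhile_replicate)
  next
    case lt: False
    define y where "y = take (length d - i) d"
    have "d \<noteq> []"
      using lt by auto
    then have "y \<noteq> []" "hd y \<noteq> a"
      using lt hd_ne by (auto simp: y_def hd_take)
    then have "takeWhile (\<lambda>x. x = a) y = []"
      by (cases y) auto
    then show ?thesis
      using lt that by (simp add: seg_le_ge takeWhile_append y_def[symmetric])
  qed
  have "length d \<le> k \<and> length d \<le> h"
    using tw[OF ge(1)] tw[OF ge(2)] eq ge False by (auto split: if_splits)
  moreover have "k mod m = h mod m"
    using md by (rule mod_add_right_cancel_nat)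
  ultimately show ?thesis
    by (simp add: cong_def)
qed simp

section \<open>The equivalence of pairs and its normal forms\<close>

lemma relI:
  "n \<le> j \<Longrightarrow> k \<le> i \<Longrightarrow> cong i j \<Longrightarrow> seg k i @ z = seg n j @ w \<Longrightarrow> rel (n, w) (k, z)"
  by (auto simp: rel_def)

lemma rel_cong: "cong n k \<Longrightarrow> rel (n, w) (k, w)"
  by (rule relI[of n n k k]) (auto intro: cong_sym)

lemma rel_refl: "rel s s"
  by (metis rel_cong cong_refl surj_pair)

lemma rel_sym: "rel s t \<Longrightarrow> rel t s"
  unfolding rel_def by (metis cong_sym)

text \<open>The middle pair is extended to length \<open>i\<close> in one relation and
  \<open>j'\<close> in the other. The relation with the shorter extension is prolonged to the longer
  one; \<open>seg_cong\<close> and \<open>cong_add\<close> carry the added segment across the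
  congruence.\<close>

lemma rel_trans:
  assumes "rel s t" "rel t u"
  shows "rel s u"
proof -
  obtain n w k z h y where s: "s = (n, w)" and t: "t = (k, z)" and u: "u = (h, y)"
    by (cases s, cases t, cases u) auto
  obtain i j where 1: "n \<le> j" "k \<le> i" "cong i j" "seg k i @ z = seg n j @ w"
    using assms(1) by (auto simp: rel_def s t)
  obtain i' j' where 2: "k \<le> j'" "h \<le> i'" "cong i' j'" "seg h i' @ y = seg k j' @ z"
    using assms(2) by (auto simp: rel_def t u)
  show ?thesis
  proof (cases "i \<le> j'")
    case True
    then obtain e where e: "j' = i + e"
      using le_Suc_ex by blast
    have "seg h i' @ y = seg i j' @ seg k i @ z"
      using 2 1(2) True by (metis append_assoc seg_append_seg)
    also have "\<dots> = seg j (j + e) @ seg n j @ w"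
      using 1(4) seg_cong[OF 1(3)] by (simp add: e)
    also have "\<dots> = seg n (j + e) @ w"
      using 1(1) by (metis append_assoc le_add1 seg_append_seg)
    finally have "seg h i' @ y = seg n (j + e) @ w" .
    moreover have "cong i' (j + e)"
      using 2(3) cong_add[OF 1(3)] e cong_trans by blast
    ultimately show ?thesis
      using 1(1) 2(2) unfolding s u by (intro relI[of n "j + e" h i']) auto
  next
    case False
    then obtain e where e: "i = j' + e"
      using le_Suc_ex nat_le_linear by blast
    have "seg n j @ w = seg j' i @ seg k j' @ z"
      using 1(4) 2(1) False by (metis append_assoc nat_le_linear seg_append_seg)
    also have "\<dots> = seg i' (i' + e) @ seg h i' @ y"
      using 2(4) seg_cong[OF 2(3)] by (simp add: e)
    also have "\<dots> = seg h (i' + e) @ y"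
      using 2(2) by (metis append_assoc le_add1 seg_append_seg)
    finally have "seg h (i' + e) @ y = seg n j @ w" by simp
    moreover have "cong (i' + e) j"
      using 1(3) cong_add[OF 2(3)] e cong_trans by blast
    ultimately show ?thesis
      using 1(1) 2(2) unfolding s u by (intro relI[of n j h "i' + e"]) auto
  qed
qed

lemma ex_cong_less: "\<exists>k < length d + m. cong n k"
proof (cases "n < length d + m")
  case False
  have "(length d + (n - length d) mod m) mod m = n mod m"
    using False by (simp add: mod_add_right_eq)
  moreover have "(n - length d) mod m < m"
    using m_pos by simp
  ultimately show ?thesis
    using False by (intro exI[of _ "length d + (n - length d) mod m"]) (auto simp: cong_def)
qed (use cong_refl in blast)

text \<open>Each forbidden first letter is cancelled at the cost of changing the length, so the
  induction on \<open>w\<close> leaves \<open>n\<close> arbitrary.\<close>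

lemma ex_normal: "\<exists>k z. normal k z \<and> rel (n, w) (k, z)"
proof (induction w arbitrary: n)
  case Nil
  show ?case
    using ex_cong_less[of n] rel_cong[of n _ "[]"] unfolding normal_def by blast
next
  case (Cons e w)
  obtain k where k: "k < length d + m" "cong n k"
    using ex_cong_less by blast
  show ?case
  proof (cases "e \<in> forb k")
    case False
    then show ?thesis
      using k rel_cong by (intro exI[of _ k] exI[of _ "e # w"]) (auto simp: normal_def)
  next
    case True
    then consider (drop) "k > 0" "e = hd (suff k)" | (loop) "length d \<le> k" "e = a"
      by (auto simp: forb_def split: if_splits)
    then have "\<exists>h. rel (k, e # w) (h, w)"
    proof cases
      case drop
      then show ?thesis
        using seg_Suc[of "k - 1"] by (intro exI[of _ "k - 1"] relI[of k k "k - 1" k]) auto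
    next
      case loop
      \<comment> \<open>The length \<open>k\<close> is first replaced by the congruent
        \<open>k + m\<close>, whose suffix begins with \<open>a\<close> because
        \<open>m \<ge> 1\<close>; cancelling this \<open>a\<close> leaves length
        \<open>k + m - 1\<close>.\<close>
      have "Suc (k + m - 1) = k + m"
        using m_pos by simp
      then have "seg (k + m - 1) (k + m) = [a]"
        using seg_Suc[of "k + m - 1"] hd_suff[of "k + m"] loop m_pos by simp
      moreover have "cong (k + m) k"
        using loop by (simp add: cong_def)
      ultimately show ?thesis
        using loop by (intro exI[of _ "k + m - 1"] relI[of k k "k + m - 1" "k + m"]) auto
    qed
    then obtain h where "rel (k, e # w) (h, w)" ..
    then show ?thesis
      using Cons.IH[of h] rel_cong[OF k(2)] rel_trans by metis
  qed
qed

text \<open>After cancelling the shorter extension, one word is the other preceded by a segment. If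
  that segment is nonempty, its first letter turns out to be forbidden.\<close>

lemma normal_unique:
  assumes "normal n w" "normal k z" "rel (n, w) (k, z)"
  shows "(n, w) = (k, z)"
proof -
  \<comment> \<open>The symmetric statement is proved for the case in which the second pair has the
    shorter extension; the other case follows by exchanging the pairs.\<close>
  have *: "(n, w) = (k, z)"
    if N: "normal n w" "normal k z" and c: "cong i j" "n \<le> j" "k \<le> i"
      and eq: "seg k i @ z = seg n j @ w" and le: "i - k \<le> j - n" for n w k z i j
  proof -
    define e where "e = i - k"
    define h where "h = j - e"
    have i: "i = k + e" and j: "j = h + e" and nh: "n \<le> h"
      using c le by (auto simp: e_def h_def)
    have "seg k i @ z = seg h j @ seg n h @ w"
      using eq nh by (metis append_assoc j le_add1 seg_append_seg)
    then have seq: "seg k i = seg h j" and z: "z = seg n h @ w"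
      by (auto simp: append_eq_append_conv i j)
    have kh: "cong k h"
      using c(1) seq unfolding i j by (rule cong_cancel_seg)
    have lt: "n < length d + m" "k < length d + m"
      using N by (auto simp: normal_def)
    show ?thesis
    proof (cases "h = n")
      case True
      then have "k = n"
        using kh lt cong_less_imp_eq by blast
      then show ?thesis
        using True z by simp
    next
      case False
      then have "seg n h \<noteq> []"
        using nh by (metis length_seg list.size(3) zero_less_diff nat_less_le less_numeral_extra(3))
      then have "z \<noteq> []" "hd z = hd (suff h)"
        using nh z hd_seg[of n h] False by auto
      then have nf: "hd (suff h) \<notin> forb k"
        using N(2) by (auto simp: normal_def)
      then have "k \<noteq> h"
        using False nh by (auto simp: forb_def)
      then have ge: "length d \<le> k" "length d \<le> h" "k mod m = h mod m"
        using kh by (auto simp: cong_def)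
      \<comment> \<open>Two distinct congruent lengths cannot both be below
        \<open>length d + m\<close>, so \<open>h\<close> is at least that large.\<close>
      then have "length d < h"
        using kh cong_less_imp_eq[of k h] \<open>k \<noteq> h\<close> lt m_pos by linarith
      then show ?thesis
        using nf ge hd_suff by (auto simp: forb_def)
    qed
  qed
  obtain i j where ij: "cong i j" "n \<le> j" "k \<le> i" "seg k i @ z = seg n j @ w"
    using assms(3) by (auto simp: rel_def)
  show ?thesis
  proof (cases "i - k \<le> j - n")
    case True
    then show ?thesis
      using *[of n w k z i j] ij assms by simp
  next
    case False
    then show ?thesis
      using *[of k z n w j i] ij assms cong_sym by simp
  qed
qed

text \<open>Congruent suffixes differ only by a power of \<open>a\<close>, so they have equally many
  letters other than \<open>a\<close>; this invariant separates infinitely many cosets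
  below.\<close>

lemma rel_same_count:
  assumes "rel (n, w) (n, z)"
  shows "length (filter (\<lambda>x. x \<noteq> a) w) = length (filter (\<lambda>x. x \<noteq> a) z)"
proof -
  let ?c = "\<lambda>w. length (filter (\<lambda>x. x \<noteq> a) w)"
  obtain i j where ij: "n \<le> j" "n \<le> i" "cong i j" "seg n i @ z = seg n j @ w"
    using assms by (auto simp: rel_def)
  have c: "?c (seg n i) + ?c (suff n) = ?c (suff i)" if "n \<le> i" for i
    using arg_cong[OF seg_append_suff[OF that], of ?c] by simp
  have "?c (suff i) = ?c (suff j)"
    using ij(3) by (auto simp: cong_def suff_ge)
  then have "?c (seg n i) = ?c (seg n j)"
    using c ij(1,2) by (metis add_right_cancel)
  then show ?thesis
    using arg_cong[OF ij(4), of ?c] by simp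
qed

end

section \<open>Graph inverse semigroups\<close>

declare gis_mult.simps(1) [simp del]

context wf_digraph
begin

definition walks_from :: "'a \<Rightarrow> 'b list set" where
  "walks_from v = {w. \<exists>u. awalk v w u}"

lemma mem_paths_iff: "p \<in> paths G \<longleftrightarrow> snd p \<in> walks_from (fst p)"
  by (simp add: paths_def walks_from_def)

lemma walks_from_append_iff:
  "p @ q \<in> walks_from v \<longleftrightarrow> p \<in> walks_from v \<and> q \<in> walks_from (awlast v p)"
  by (auto simp: walks_from_def)

text \<open>Both parts of a split walk are walks, so only \<open>u\<close> has to be required to be
  a path.\<close>

lemma is_decomp_iff:
  "is_decomp G u p v \<longleftrightarrow>
     u \<in> paths G \<and> fst p = fst u \<and> snd u = snd p @ snd v \<and> fst v = awlast (fst u) (snd p)"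
  unfolding is_decomp_def mem_paths_iff pran_def papp_def
  by (cases u, cases p, cases v) (auto simp: walks_from_append_iff)

lemma is_decomp_papp: "is_decomp G u p v \<Longrightarrow> p \<bullet> v = u"
  by (simp add: is_decomp_def)

lemma is_decomp_paths: "is_decomp G u p v \<Longrightarrow> v \<in> paths G"
  by (simp add: is_decomp_def)

lemma is_decomp_dom: "is_decomp G u p v \<Longrightarrow> fst p = fst u"
  by (simp add: is_decomp_iff)

lemma is_decomp_unique: "is_decomp G u p v \<Longrightarrow> is_decomp G u q v \<Longrightarrow> p = q"
  by (simp add: is_decomp_iff prod_eq_iff)

lemma is_decomp_the: "is_decomp G u p v \<Longrightarrow> (THE p. is_decomp G u p v) = p"
  using is_decomp_unique by blast

lemma is_decomp_refl: "u \<in> paths G \<Longrightarrow> is_decomp G u (fst u, []) u"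
  by (simp add: is_decomp_iff)

lemma is_decomp_antisym:
  "is_decomp G u p v \<Longrightarrow> is_decomp G v q u \<Longrightarrow> u = v \<and> snd p = [] \<and> snd q = []"
  by (auto simp: is_decomp_iff prod_eq_iff)

lemma is_decomp_NilD: "is_decomp G u p v \<Longrightarrow> snd p = [] \<Longrightarrow> u = v"
  by (simp add: is_decomp_iff prod_eq_iff)

lemma snd_papp: "snd (p \<bullet> v) = snd p @ snd v"
  by (simp add: papp_def)

lemma fst_papp: "fst (p \<bullet> v) = fst p"
  by (simp add: papp_def)

lemma papp_eq_selfD: "p \<bullet> v = v \<Longrightarrow> snd p = []"
  by (metis append_self_conv2 snd_papp)

lemma is_decomp_transfer:
  assumes "is_decomp G u p v" "w \<in> paths G" "fst w = fst v"
  shows "is_decomp G (p \<bullet> w) p w"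
  using assms by (auto simp: is_decomp_def papp_def mem_paths_iff walks_from_append_iff pran_def)

section \<open>Products, idempotents, natural order and inverses\<close>

abbreviation carr :: "('a, 'b) gis set" where
  "carr \<equiv> carrier (\<S> G)"

lemma smult_gis [simp]: "s \<odot>\<^bsub>\<S> G\<^esub> t = gis_mult G s t"
  by (simp add: graph_inverse_semigroup_def)

lemma Zero_carr [simp]: "Zero \<in> carr"
  by (simp add: graph_inverse_semigroup_def)

lemma Elem_carr [simp]:
  "Elem u v \<in> carr \<longleftrightarrow> u \<in> paths G \<and> v \<in> paths G \<and> fst u = fst v"
  by (auto simp: graph_inverse_semigroup_def simp del: split_paired_Ex)

lemma mult_Zero [simp]: "gis_mult G s Zero = Zero"
  by (cases s; simp)

lemma mult_left:
  assumes "is_decomp G u p v"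
  shows "gis_mult G (Elem t u) (Elem v w) = Elem t (p \<bullet> w)"
  unfolding gis_mult.simps(1) is_decomp_the[OF assms]
  by (rule if_P) (rule exI, rule assms)

text \<open>The definition tests the other decomposition first. If both exist, both left factors are
  empty and the two formulas agree.\<close>

lemma mult_right:
  assumes "is_decomp G v p u" "fst t = fst u" "fst v = fst w"
  shows "gis_mult G (Elem t u) (Elem v w) = Elem (p \<bullet> t) w"
proof (cases "\<exists>q. is_decomp G u q v")
  case True
  then obtain q where q: "is_decomp G u q v" ..
  then have "u = v" "snd p = []" "snd q = []" "fst p = fst v" "fst q = fst u"
    using assms(1) is_decomp_antisym[of v p u q] by (simp_all add: is_decomp_dom)
  then show ?thesis
    using q assms(2,3) by (simp add: mult_left papp_def prod_eq_iff)
next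
  case False
  then show ?thesis
    unfolding gis_mult.simps(1) is_decomp_the[OF assms(1)] if_not_P[OF False]
    by (intro if_P) (rule exI, rule assms)
qed

lemma mult_cases:
  obtains (left) p where "is_decomp G u p v"
  | (right) p where "is_decomp G v p u"
  | (zero) "\<And>t w. gis_mult G (Elem t u) (Elem v w) = Zero"
  by (fastforce simp: gis_mult.simps(1))

lemma mult_middle_eq:
  "v \<in> paths G \<Longrightarrow> fst v = fst w \<Longrightarrow> gis_mult G (Elem u v) (Elem v w) = Elem u w"
  by (simp add: mult_left[OF is_decomp_refl] papp_def prod_eq_iff)

text \<open>Squaring a pair prepends a path to one of its components; if the pair is unchanged, that
  path is empty and the components coincide.\<close>

lemma idempotents_gis:
  "idempotents (\<S> G) = insert Zero ((\<lambda>u. Elem u u) ` paths G)"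
proof -
  have "u = v" if "Elem u v \<in> carr" and eq: "gis_mult G (Elem u v) (Elem u v) = Elem u v" for u v
    using mult_cases[of v u]
  proof cases
    case (left p)
    then have "p \<bullet> v = v"
      using eq mult_left[OF left, of u v] by simp
    with left show ?thesis
      using is_decomp_NilD papp_eq_selfD by metis
  next
    case (right p)
    then have "p \<bullet> u = u"
      using that mult_right[OF right, of u v] by simp
    with right show ?thesis
      using is_decomp_NilD papp_eq_selfD by metis
  next
    case zero
    then show ?thesis
      using eq by simp
  qed
  then have "x \<in> insert Zero ((\<lambda>u. Elem u u) ` paths G)" if "x \<in> idempotents (\<S> G)" for x
    using that by (cases x) (simp_all add: idempotents_def image_iff, metis)
  moreover have "Elem u u \<in> idempotents (\<S> G)" if "u \<in> paths G" for u
    using that by (simp add: idempotents_def mult_middle_eq)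
  moreover have "Zero \<in> idempotents (\<S> G)"
    by (simp add: idempotents_def)
  ultimately show ?thesis
    by blast
qed

text \<open>A nonzero product of \<open>Elem w w\<close> with a pair either prepends one path to
  both components or leaves the pair unchanged. Going up in the order thus strips a common initial
  path.\<close>

lemma nat_le_Elem_iff:
  "nat_le (\<S> G) (Elem u v) s \<longleftrightarrow>
    Elem u v \<in> carr \<and> (\<exists>p x y. s = Elem x y \<and> fst x = fst y \<and> is_decomp G u p x \<and> is_decomp G v p y)"
  (is "?l \<longleftrightarrow> ?r")
proof
  assume ?l
  then obtain e where uv: "Elem u v \<in> carr" and s: "s \<in> carr"
    and e: "e \<in> idempotents (\<S> G)" "Elem u v = gis_mult G e s"
    unfolding nat_le_def smult_gis by metis
  have "e \<noteq> Zero" "s \<noteq> Zero"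
    using e(2) by (auto)
  then obtain w x y where w: "e = Elem w w" "w \<in> paths G" and xy: "s = Elem x y"
    using e(1) by (cases s) (auto simp: idempotents_gis)
  from xy s have p: "x \<in> paths G" "y \<in> paths G" "fst x = fst y"
    by auto
  from mult_cases[of w x] show ?r
  proof cases
    case (left p)
    then have "u = w" "v = p \<bullet> y"
      using e(2) w xy by (simp_all add: mult_left)
    then show ?thesis
      using left p uv xy is_decomp_transfer[OF left, of y] by metis
  next
    case (right q)
    then have "u = x" "v = y"
      using e(2) w xy p by (simp_all add: mult_right is_decomp_papp)
    then show ?thesis
      using uv xy p is_decomp_refl[of u] is_decomp_refl[of v] by metis
  next
    case zero
    then show ?thesis
      using e(2) w xy by simp
  qed
next
  assume ?r
  then obtain p x y where r: "Elem u v \<in> carr" "s = Elem x y" "fst x = fst y"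
    "is_decomp G u p x" "is_decomp G v p y" by blast
  then have "gis_mult G (Elem u u) s = Elem u v"
    by (simp add: mult_left is_decomp_papp)
  moreover have "Elem u u \<in> idempotents (\<S> G)"
    using r(1) by (simp add: idempotents_gis)
  moreover have "s \<in> carr"
    using r is_decomp_paths by auto
  ultimately show ?l
    using r(1) unfolding nat_le_def smult_gis by metis
qed

text \<open>One half of the uniqueness of inverses: \<open>sinv_Elem\<close> applies it to each of
  the two defining equations, and the two extensions obtained must then be empty.\<close>

lemma quasi_inverse_decomp:
  assumes carr: "Elem u v \<in> carr" "Elem x y \<in> carr"
    and eq: "gis_mult G (gis_mult G (Elem u v) (Elem x y)) (Elem u v) = Elem u v"
  shows "\<exists>p. is_decomp G v p x \<and> u = p \<bullet> y"
  using mult_cases[of v x]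
proof cases
  case (left p)
  then have 1: "gis_mult G (Elem u (p \<bullet> y)) (Elem u v) = Elem u v" "fst (p \<bullet> y) = fst u"
    using carr eq by (simp_all add: mult_left papp_def is_decomp_dom)
  from mult_cases[of "p \<bullet> y" u] have "u = p \<bullet> y"
  proof cases
    case (left q)
    then have "q \<bullet> v = v"
      using 1 mult_left[OF left, of u v] by simp
    with left show ?thesis
      using is_decomp_NilD papp_eq_selfD by metis
  next
    case (right q)
    then have "q \<bullet> u = u"
      using 1 carr mult_right[OF right, of u v] by simp
    with right show ?thesis
      using is_decomp_NilD papp_eq_selfD by metis
  next
    case zero
    then show ?thesis
      using 1 by simp
  qed
  with left show ?thesis
    by blast
next
  case (right p)
  then have 1: "gis_mult G (Elem (p \<bullet> u) y) (Elem u v) = Elem u v"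
    using carr eq mult_right[OF right, of u y] by simp
  have px: "fst p = fst x"
    using right by (rule is_decomp_dom)
  from mult_cases[of y u] have "snd p = [] \<and> y = u"
  proof cases
    case (left q)
    then have "p \<bullet> u = u" "q \<bullet> v = v"
      using 1 mult_left[OF left, of "p \<bullet> u" v] by simp_all
    with left show ?thesis
      using is_decomp_NilD papp_eq_selfD by metis
  next
    case (right q)
    then have "q \<bullet> p \<bullet> u = u"
      using 1 carr px mult_right[OF right, of "p \<bullet> u" v] by (simp add: fst_papp)
    then have "snd p = []" "snd q = []"
      by (metis append_is_Nil_conv append_self_conv2 append_assoc snd_papp)+
    with right show ?thesis
      using is_decomp_NilD by metis
  next
    case zero
    then show ?thesis
      using 1 by simp
  qed
  then have "x = v" "y = u"
    using right is_decomp_NilD by blast+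
  moreover have "(fst v, []) \<bullet> u = u"
    using carr by (simp add: papp_def prod_eq_iff)
  ultimately show ?thesis
    using carr is_decomp_refl[of v] by (metis Elem_carr)
next
  case zero
  then show ?thesis
    using eq by simp
qed

lemma sinv_Elem:
  assumes "Elem u v \<in> carr"
  shows "sinv (\<S> G) (Elem u v) = Elem v u"
  unfolding sinv_def smult_gis
proof (rule the_equality)
  show "Elem v u \<in> carr \<and>
      gis_mult G (gis_mult G (Elem u v) (Elem v u)) (Elem u v) = Elem u v \<and>
      gis_mult G (gis_mult G (Elem v u) (Elem u v)) (Elem v u) = Elem v u"
    using assms by (simp add: mult_middle_eq)
next
  fix t
  assume t: "t \<in> carr \<and> gis_mult G (gis_mult G (Elem u v) t) (Elem u v) = Elem u v \<and>
    gis_mult G (gis_mult G t (Elem u v)) t = t"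
  have "t \<noteq> Zero"
    using t by auto
  then obtain x y where xy: "t = Elem x y"
    by (cases t) auto
  obtain p q where p: "is_decomp G v p x" "u = p \<bullet> y" and q: "is_decomp G y q u"
    using quasi_inverse_decomp[of u v x y] quasi_inverse_decomp[of x y u v] assms t xy by auto
  have "snd u = snd p @ snd q @ snd u"
    using p(2) is_decomp_papp[OF q] snd_papp by metis
  then have "snd p = []" "snd q = []"
    by simp_all
  then show "t = Elem v u"
    using p(1) q xy is_decomp_NilD by metis
qed

end

section \<open>Cosets of a subsemigroup of cycle type\<close>

locale loop_cycle = fin_digraph G + cycle_word a m d
  for G :: "('a, 'b) pre_digraph" and a :: 'b and m :: nat and d :: "'b list" +
  assumes a_arc: "a \<in> arcs G"
    and head_a: "head G a = tail G a"
    and d_walk: "d \<in> walks_from (tail G a)"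
begin

text \<open>The vertex at which \<open>suff n\<close> starts. For \<open>n \<ge> length d\<close>
  the truncated subtraction yields the vertex of the loop.\<close>

definition base :: "nat \<Rightarrow> 'a" where
  "base n = awlast (tail G a) (take (length d - n) d)"

definition spoke :: "nat \<Rightarrow> ('a, 'b) dpath" where
  "spoke n = (base n, suff n)"

definition subsemi :: "('a, 'b) gis set" where
  "subsemi = {Elem (spoke i) (spoke j) | i j. cong i j}"

text \<open>The coset represented by a pair, described by words alone; see
  \<open>coset_eq_cls\<close>.\<close>

definition cls :: "nat \<times> 'b list \<Rightarrow> ('a, 'b) gis set" where
  "cls s = {Elem (spoke k) (base k, z) | k z. z \<in> walks_from (base k) \<and> rel s (k, z)}"

definition reps :: "(nat \<times> 'b list) set" where
  "reps = {(n, w). normal n w \<and> w \<in> walks_from (base n)}"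

section \<open>Suffixes and segments as walks\<close>

lemma base_ge: "length d \<le> n \<Longrightarrow> base n = tail G a"
  by (simp add: base_def)

lemma base_cong: "cong i j \<Longrightarrow> base i = base j"
  by (auto simp: cong_def base_ge)

lemma awalk_replicate_a: "awalk (tail G a) (replicate n a) (tail G a)"
  using a_arc head_a by (induction n) (auto simp: awalk_simps)

lemma awalk_suff: "awalk (base n) (suff n) (awlast (tail G a) d)"
proof -
  obtain u where u: "awalk (tail G a) d u"
    using d_walk by (auto simp: walks_from_def)
  then have "awalk (tail G a) (take (length d - n) d @ drop (length d - n) d) u"
    by simp
  then have "awalk (base n) (drop (length d - n) d) u"
    unfolding awalk_append_iff base_def by blast
  moreover have "awalk (base n) (replicate (n - length d) a) (base n)"
    using calculation awalk_replicate_a base_ge awalk_hd_in_verts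
    by (cases "length d \<le> n") (auto simp: awalk_Nil_iff)
  ultimately show ?thesis
    using u unfolding suff_def by (metis awalk_appendI awlast_of_awalk awalkE)
qed

lemma awalk_seg:
  assumes "k \<le> i"
  shows "awalk (base i) (seg k i) (base k)"
\<comment> \<open>A nonempty \<open>suff k\<close> determines the vertex where the segment ends; for
  \<open>k = 0\<close> it is empty, and the segment is all of \<open>suff i\<close>.\<close>
proof (cases "k = 0")
  case True
  then show ?thesis
    using awalk_suff[of i] by (simp add: seg_def base_def)
next
  case False
  let ?u = "awlast (base i) (seg k i)"
  have "awalk (base i) (seg k i @ suff k) (awlast (tail G a) d)"
    using awalk_suff[of i] seg_append_suff[OF assms] by simp
  then have 1: "awalk (base i) (seg k i) ?u" "awalk ?u (suff k) (awlast (tail G a) d)"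
    unfolding awalk_append_iff by blast+
  have "suff k \<noteq> []"
    using False by (metis length_suff list.size(3))
  then have "?u = base k"
    using awalk_ends[OF 1(2) awalk_suff[of k]] by simp
  then show ?thesis
    using 1(1) by simp
qed

lemma awlast_seg: "k \<le> i \<Longrightarrow> awlast (base i) (seg k i) = base k"
  using awalk_seg by auto

lemma spoke_path: "spoke n \<in> paths G"
  using awalk_suff by (auto simp: mem_paths_iff spoke_def walks_from_def)

lemma spoke_eq_iff [simp]: "spoke i = spoke j \<longleftrightarrow> i = j"
  by (auto simp: spoke_def)

lemma fst_spoke [simp]: "fst (spoke n) = base n"
  by (simp add: spoke_def)

lemma seg_append_walk_iff:
  "k \<le> i \<Longrightarrow> seg k i @ z \<in> walks_from (base i) \<longleftrightarrow> z \<in> walks_from (base k)"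
  using awalk_seg[of k i] awlast_seg[of k i]
  by (auto simp: walks_from_append_iff walks_from_def)

lemma rel_walks_from:
  "rel (n, w) (k, z) \<Longrightarrow> w \<in> walks_from (base n) \<Longrightarrow> z \<in> walks_from (base k)"
  unfolding rel_def using seg_append_walk_iff base_cong by (metis fst_conv snd_conv)

lemma is_decomp_spoke_iff:
  "is_decomp G (spoke i) p x \<longleftrightarrow> (\<exists>k\<le>i. p = (base i, seg k i) \<and> x = spoke k)"
proof
  assume dec: "is_decomp G (spoke i) p x"
  define k where "k = length (snd x)"
  have eq: "suff i = snd p @ snd x" and p: "fst p = base i"
    and x: "fst x = awlast (base i) (snd p)"
    using dec by (auto simp: is_decomp_iff spoke_def)
  have "k \<le> i"
    using arg_cong[OF eq, of length] by (simp add: k_def)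
  then have "seg k i @ suff k = snd p @ snd x"
    using eq seg_append_suff by simp
  then have "seg k i = snd p" "suff k = snd x"
    using k_def by simp_all
  then show "\<exists>k\<le>i. p = (base i, seg k i) \<and> x = spoke k"
    using \<open>k \<le> i\<close> p x awlast_seg by (metis prod.collapse spoke_def)
next
  assume "\<exists>k\<le>i. p = (base i, seg k i) \<and> x = spoke k"
  then show "is_decomp G (spoke i) p x"
    using spoke_path[of i] seg_append_suff awlast_seg by (auto simp: is_decomp_iff spoke_def)
qed

text \<open>A suffix of the circuit is a power of \<open>a\<close> with some exponent
  \<open>k \<le> m\<close>, so both components have length \<open>k + length d\<close> up to
  multiples of \<open>m\<close>. Conversely, division by \<open>m\<close> recovers \<open>k\<close>
  as the common remainder.\<close>

lemma cycle_type_eq_subsemi: "cycle_type G (ppow (arc_path G a) m) (tail G a, d) = subsemi"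
proof -
  have rep: "concat (replicate r (replicate n a)) = replicate (r * n) a" for r n
    by (induction r) (simp_all add: replicate_add)
  have pw: "ppow (arc_path G a) m = (tail G a, replicate m a)"
    using rep[of m 1] by (simp add: ppow_def arc_path_def)
  have spd: "spoke (length d) = (tail G a, d)"
    by (simp add: spoke_def base_ge suff_ge)
  have sp: "(tail G a, replicate k a) \<bullet> ppow (tail G a, replicate m a) r \<bullet> (tail G a, d) =
      spoke (k + r * m + length d)" for k r
    by (simp add: papp_def ppow_def spoke_def base_ge suff_ge rep replicate_add)
  have suf: "psuffix G v (tail G a, replicate m a) \<longleftrightarrow> (\<exists>k\<le>m. v = (tail G a, replicate k a))" for v
  proof
    assume "psuffix G v (tail G a, replicate m a)"
    then obtain p where "replicate m a = snd p @ snd v" "fst v = awlast (tail G a) (snd p)"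
      by (auto simp: psuffix_def is_decomp_iff)
    then have "snd p = replicate (length (snd p)) a" "snd v = replicate (length (snd v)) a"
      "length (snd p) + length (snd v) = m"
      by (metis append_eq_conv_conj drop_replicate length_append length_replicate take_replicate)+
    moreover have "fst v = tail G a"
      using calculation(1) \<open>fst v = _\<close> awlast_of_awalk[OF awalk_replicate_a[of "length (snd p)"]]
      by simp
    ultimately show "\<exists>k\<le>m. v = (tail G a, replicate k a)"
      by (metis le_add2 prod.collapse)
  next
    assume "\<exists>k\<le>m. v = (tail G a, replicate k a)"
    then obtain k where k: "k \<le> m" "v = (tail G a, replicate k a)"
      by blast
    have "is_decomp G (tail G a, replicate m a) (tail G a, replicate (m - k) a) v"
      using k awalk_replicate_a by (auto simp: is_decomp_iff mem_paths_iff walks_from_def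
        awlast_of_awalk[OF awalk_replicate_a] simp flip: replicate_add)
    then show "psuffix G v (tail G a, replicate m a)"
      unfolding psuffix_def by blast
  qed
  have sufd: "psuffix G q (tail G a, d) \<longleftrightarrow> (\<exists>k\<le>length d. q = spoke k)" for q
    unfolding psuffix_def spd[symmetric] is_decomp_spoke_iff by auto
  have "cycle_type G (ppow (arc_path G a) m) (tail G a, d) =
    {Elem (spoke (k + r * m + length d)) (spoke (k + s * m + length d)) | k r s. k \<le> m} \<union>
    {Elem (spoke k) (spoke k) | k. k \<le> length d}" (is "_ = ?A \<union> ?B")
    unfolding cycle_type_def pw suf sufd sp[symmetric] by blast
  also have "\<dots> = subsemi"
  proof (intro equalityI Un_least subsetI)
    fix x assume "x \<in> ?A"
    then obtain k r s where x: "x = Elem (spoke (k + r * m + length d)) (spoke (k + s * m + length d))"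
      by blast
    have "(k + r * m + length d) mod m = (k + s * m + length d) mod m"
      by (metis add.assoc add.commute mod_mult_self1)
    then show "x \<in> subsemi"
      unfolding x subsemi_def cong_def by auto
  next
    fix x assume "x \<in> ?B"
    then show "x \<in> subsemi"
      unfolding subsemi_def using cong_refl by blast
  next
    fix x assume "x \<in> subsemi"
    then obtain i j where x: "x = Elem (spoke i) (spoke j)" and c: "cong i j"
      by (auto simp: subsemi_def)
    show "x \<in> ?A \<union> ?B"
    proof (cases "length d \<le> i \<and> length d \<le> j")
      case True
      then have "((i - length d) + length d) mod m = ((j - length d) + length d) mod m"
        using c by (auto simp: cong_def)
      then have md: "(i - length d) mod m = (j - length d) mod m"
        by (rule mod_add_right_cancel_nat)
      define k where "k = (i - length d) mod m"
      have "i = k + (i - length d) div m * m + length d" "j = k + (j - length d) div m * m + length d"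
        using True by (simp_all add: k_def mod_div_mult_eq) (simp add: md mod_div_mult_eq)
      then obtain r s where "i = k + r * m + length d" "j = k + s * m + length d"
        by blast
      moreover have "k \<le> m"
        using m_pos by (simp add: k_def less_imp_le)
      ultimately show ?thesis
        unfolding x by blast
    next
      case False
      then show ?thesis
        using c unfolding x by (auto simp: cong_def)
    qed
  qed
  finally show ?thesis .
qed

text \<open>If \<open>n\<close> exceeds \<open>j\<close>, the missing segment is prepended to
  \<open>spoke i\<close>; by \<open>seg_cong\<close> the result is again a spoke, and the new
  lengths stay congruent.\<close>

lemma mult_L:
  assumes "cong i j" "w \<in> walks_from (base n)"
  shows "\<exists>i' j'. cong i' j' \<and> n \<le> j' \<and>
    gis_mult G (Elem (spoke i) (spoke j)) (Elem (spoke n) (base n, w)) =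
      Elem (spoke i') (base j', seg n j' @ w)"
proof (cases "n \<le> j")
  case True
  then have "is_decomp G (spoke j) (base j, seg n j) (spoke n)"
    by (auto simp: is_decomp_spoke_iff)
  then show ?thesis
    using assms(1) True by (intro exI[of _ i] exI[of _ j]) (simp add: mult_left papp_def)
next
  case False
  define e where "e = n - j"
  have n: "n = j + e"
    using False by (simp add: e_def)
  have "is_decomp G (spoke n) (base n, seg j n) (spoke j)"
    by (auto simp: is_decomp_spoke_iff n)
  moreover have "(base n, seg j n) \<bullet> spoke i = spoke (i + e)"
    using seg_cong[OF assms(1)] seg_append_suff[of i "i + e"] base_cong[OF cong_add[OF assms(1)]]
    by (simp add: papp_def spoke_def n)
  ultimately show ?thesis
    using assms(1) cong_add[OF assms(1), of e]
    by (intro exI[of _ "i + e"] exI[of _ n]) (simp add: mult_right base_cong n)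
qed

text \<open>By \<open>mult_L\<close> the products have a spoke as first component. Going up strips a
  common initial path, which has to be a segment because the suffixes of a spoke are spokes.\<close>

lemma coset_eq_cls:
  assumes w: "w \<in> walks_from (base n)"
  shows "coset_of (\<S> G) subsemi (Elem (spoke n) (base n, w)) = cls (n, w)"
proof (intro equalityI subsetI)
  fix s
  assume "s \<in> coset_of (\<S> G) subsemi (Elem (spoke n) (base n, w))"
  then obtain i j where "cong i j"
    "nat_le (\<S> G) (gis_mult G (Elem (spoke i) (spoke j)) (Elem (spoke n) (base n, w))) s"
    by (auto simp: coset_of_def subsemi_def)
  then obtain i j where ij: "cong i j" "n \<le> j"
    and le: "nat_le (\<S> G) (Elem (spoke i) (base j, seg n j @ w)) s"
    using mult_L[OF _ w] by metis
  then obtain p x y where s: "s = Elem x y" "fst x = fst y" and x: "is_decomp G (spoke i) p x"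
    and y: "is_decomp G (base j, seg n j @ w) p y"
    unfolding nat_le_Elem_iff by blast
  obtain k where k: "k \<le> i" "p = (base i, seg k i)" "x = spoke k"
    using x is_decomp_spoke_iff by auto
  have "seg k i @ snd y = seg n j @ w"
    using y k(2) by (simp add: is_decomp_iff)
  then have "rel (n, w) (k, snd y)"
    using ij k(1) by (intro relI) auto
  moreover have "y = (base k, snd y)"
    using s(2) k(3) by (simp add: prod_eq_iff)
  ultimately show "s \<in> cls (n, w)"
    using s(1) k(3) rel_walks_from w unfolding cls_def by blast
next
  fix s
  assume "s \<in> cls (n, w)"
  then obtain k z where s: "s = Elem (spoke k) (base k, z)" and z: "z \<in> walks_from (base k)"
    and "rel (n, w) (k, z)"
    by (auto simp: cls_def)
  then obtain i j where ij: "n \<le> j" "k \<le> i" "cong i j" and eq: "seg k i @ z = seg n j @ w"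
    by (auto simp: rel_def)
  have b: "base i = base j"
    using ij(3) by (rule base_cong)
  have path: "(base j, seg n j @ w) \<in> paths G"
    using w seg_append_walk_iff[OF ij(1)] by (simp add: mem_paths_iff)
  have "is_decomp G (spoke j) (base j, seg n j) (spoke n)"
    using ij by (auto simp: is_decomp_spoke_iff)
  then have m: "gis_mult G (Elem (spoke i) (spoke j)) (Elem (spoke n) (base n, w)) =
      Elem (spoke i) (base j, seg n j @ w)"
    by (simp add: mult_left papp_def)
  have "is_decomp G (spoke i) (base i, seg k i) (spoke k)"
    using ij by (auto simp: is_decomp_spoke_iff)
  moreover have "is_decomp G (base j, seg n j @ w) (base i, seg k i) (base k, z)"
    using path eq b awlast_seg[OF ij(2)] by (simp add: is_decomp_iff)
  ultimately have "nat_le (\<S> G) (Elem (spoke i) (base j, seg n j @ w)) s"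
    unfolding nat_le_Elem_iff using path spoke_path b s by (metis Elem_carr fst_conv fst_spoke)
  moreover have "s \<in> carr"
    using s z spoke_path by (simp add: mem_paths_iff)
  ultimately show "s \<in> coset_of (\<S> G) subsemi (Elem (spoke n) (base n, w))"
    using ij(3) m unfolding coset_of_def subsemi_def smult_gis by fastforce
qed

text \<open>For a pair with first component \<open>u\<close>, the product with its inverse is
  \<open>Elem u u\<close>, which lies in \<open>L\<close> exactly when \<open>u\<close> is a
  spoke.\<close>

lemma cosets_eq: "cosets (\<S> G) subsemi = cls ` {(n, w). w \<in> walks_from (base n)}"
proof -
  have *: "t \<in> carr \<and> gis_mult G t (sinv (\<S> G) t) \<in> subsemi \<longleftrightarrow>
      (\<exists>n w. t = Elem (spoke n) (base n, w) \<and> w \<in> walks_from (base n))" for t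
  proof (cases t)
    case Zero
    then show ?thesis
      by (simp add: subsemi_def)
  next
    case (Elem u v)
    have L: "Elem u u \<in> subsemi \<longleftrightarrow> (\<exists>n. u = spoke n)"
      using cong_refl by (auto simp: subsemi_def)
    show ?thesis
    proof (cases "t \<in> carr")
      case True
      then have "gis_mult G t (sinv (\<S> G) t) = Elem u u"
        using Elem by (simp add: sinv_Elem mult_middle_eq)
      then show ?thesis
        using True L Elem by (cases v) (auto simp: mem_paths_iff)
    next
      case False
      then show ?thesis
        using spoke_path by (auto simp: mem_paths_iff)
    qed
  qed
  have "cosets (\<S> G) subsemi =
      {coset_of (\<S> G) subsemi t | t. \<exists>n w. t = Elem (spoke n) (base n, w) \<and> w \<in> walks_from (base n)}"
    unfolding cosets_def smult_gis * ..
  also have "\<dots> = cls ` {(n, w). w \<in> walks_from (base n)}"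
  proof (intro equalityI subsetI)
    fix c assume "c \<in> cls ` {(n, w). w \<in> walks_from (base n)}"
    then obtain n w where "w \<in> walks_from (base n)" "c = cls (n, w)"
      by auto
    then show "c \<in> {coset_of (\<S> G) subsemi t | t.
        \<exists>n w. t = Elem (spoke n) (base n, w) \<and> w \<in> walks_from (base n)}"
      using coset_eq_cls by blast
  qed (auto simp: coset_eq_cls)
  finally show ?thesis .
qed

lemma cls_eq_iff:
  assumes "w \<in> walks_from (base n)"
  shows "cls (n, w) = cls (k, z) \<longleftrightarrow> rel (n, w) (k, z)"
proof
  assume eq: "cls (n, w) = cls (k, z)"
  have "Elem (spoke n) (base n, w) \<in> cls (n, w)"
    using assms rel_refl by (auto simp: cls_def)
  then have "rel (k, z) (n, w)"
    unfolding eq by (auto simp: cls_def)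
  then show "rel (n, w) (k, z)"
    by (rule rel_sym)
next
  assume "rel (n, w) (k, z)"
  then show "cls (n, w) = cls (k, z)"
    unfolding cls_def using rel_sym rel_trans by blast
qed

lemma sindex_eq_ecard_reps: "sindex (\<S> G) subsemi = ecard reps"
proof -
  have "cls ` {(n, w). w \<in> walks_from (base n)} \<subseteq> cls ` reps"
  proof clarify
    fix n w assume w: "w \<in> walks_from (base n)"
    obtain k z where kz: "normal k z" "rel (n, w) (k, z)"
      using ex_normal by blast
    then have "(k, z) \<in> reps" "cls (n, w) = cls (k, z)"
      using w rel_walks_from cls_eq_iff by (auto simp: reps_def)
    then show "cls (n, w) \<in> cls ` reps"
      by blast
  qed
  then have "cosets (\<S> G) subsemi = cls ` reps"
    unfolding cosets_eq by (auto simp: reps_def)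
  moreover have "inj_on cls reps"
    unfolding inj_on_def reps_def using cls_eq_iff normal_unique by blast
  ultimately show ?thesis
    unfolding sindex_def ecard_def by (simp add: finite_image_iff card_image)
qed

end

section \<open>Circuits and the index formula\<close>

lemma (in pre_digraph) cas_del_arc: "pre_digraph.cas (del_arc a) u p v \<longleftrightarrow> cas u p v"
  by (induction p arbitrary: u) (simp_all add: pre_digraph.cas.simps)

lemma (in wf_digraph) num_paths_eq:
  "num_paths G v p = ecard {x \<in> walks_from v. x = [] \<or> hd x \<notin> pedges p}"
proof -
  have "{x \<in> paths G. fst x = v \<and> (snd x = [] \<or> hd (snd x) \<notin> pedges p)} =
      Pair v ` {x \<in> walks_from v. x = [] \<or> hd x \<notin> pedges p}"
    by (auto simp: mem_paths_iff image_iff)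
  then show ?thesis
    unfolding num_paths_def ecard_def
    by (simp add: finite_image_iff card_image inj_on_def)
qed

lemma (in wf_digraph) walks_from_del_arc:
  "wf_digraph.walks_from (del_arc a) v = {w \<in> walks_from v. a \<notin> set w}"
  using wf_digraph_del_arc[of a]
  by (auto simp: wf_digraph.walks_from_def walks_from_def pre_digraph.awalk_def cas_del_arc)

text \<open>Attachment asks for a connecting path without edges of \<open>c\<close> or
  \<open>d\<close>. An offending edge shortens any given walk: if it lies on \<open>c\<close>, the
  walk is stopped at its tail, and if it lies on \<open>d\<close>, the walk is restarted at its
  head.\<close>

lemma (in wf_digraph) attached_if_reachable:
  assumes "d \<in> paths G" "v \<in> path_verts G d" "awalk v g u"
    and c: "awalk w c w" "u \<in> set (awalk_verts w c)" "e \<in> set c" "e \<noteq> a"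
  shows "other_circuit_attached G a d"
  using assms(2,3,5)
proof (induction "length g" arbitrary: v g u rule: less_induct)
  case less
  have d: "awalk (fst d) (snd d) (awlast (fst d) (snd d))"
    using assms(1) by (auto simp: mem_paths_iff walks_from_def)
  show ?case
  proof (cases "set g \<inter> (set c \<union> set (snd d)) = {}")
    case True
    have "is_circuit G (w, c)"
      using c by (auto simp: is_circuit_def mem_paths_iff walks_from_def pran_def)
    moreover have "(v, g) \<in> paths G" "pran G (v, g) = u"
      using less.prems(2) by (auto simp: mem_paths_iff walks_from_def pran_def)
    ultimately show ?thesis
      unfolding other_circuit_attached_def
      using True less.prems c(3,4)
      by (intro exI[of _ "(w, c)"] exI[of _ e] exI[of _ "(v, g)"]) (auto simp: path_verts_def)
  next
    case False
    then obtain f where f: "f \<in> set g" "f \<in> set c \<or> f \<in> set (snd d)"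
      by blast
    then obtain g1 g2 where g: "g = g1 @ f # g2"
      by (meson split_list)
    have g1: "awalk v g1 (tail G f)" and g2: "awalk (head G f) g2 u"
      using less.prems(2) unfolding g by (auto simp: awalk_Cons_iff)
    show ?thesis
    proof (cases "f \<in> set c")
      case True
      then show ?thesis
        using less.hyps[of g1 v "tail G f"] less.prems(1) g1 g awalk_verts_arc1 by simp
    next
      case False
      then have "head G f \<in> path_verts G d"
        using f(2) awalk_verts_arc2[OF d] by (simp add: path_verts_def)
      then show ?thesis
        using less.hyps[of g2 "head G f" u] less.prems(3) g2 g by simp
    qed
  qed
qed

text \<open>A walk with no circuit inside repeats no vertex, and a finite digraph has finitely many
  such walks.\<close>

lemma (in wf_digraph) finite_walks_from_if_acyclic:
  assumes "fin_digraph G"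
    and "\<And>p c u w. p @ c @ w \<in> A \<Longrightarrow> awalk v p u \<Longrightarrow> awalk u c u \<Longrightarrow> c = []"
    and "A \<subseteq> walks_from v"
  shows "finite A"
proof -
  interpret fin_digraph G by fact
  have "A \<subseteq> (\<lambda>(u, p, v). p) ` {(u, p, v). apath u p v}"
  proof
    fix w assume w: "w \<in> A"
    then obtain u where u: "awalk v w u"
      using assms(3) by (auto simp: walks_from_def)
    have "distinct (awalk_verts v w)"
    proof (rule ccontr)
      assume "\<not> distinct (awalk_verts v w)"
      then obtain p c q y where "w = p @ c @ q" "c \<noteq> []" "awalk v p y" "awalk y c y"
        using awalk_not_distinct_decomp[OF u] by auto
      then show False
        using assms(2) w by blast
    qed
    then show "w \<in> (\<lambda>(u, p, v). p) ` {(u, p, v). apath u p v}"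
      using u by (force simp: apath_def)
  qed
  then show ?thesis
    using apaths_finite_triple finite_surj by blast
qed

context loop_cycle
begin

section \<open>Infinite index when another circuit is attached\<close>

abbreviation dp :: "('a, 'b) dpath" where
  "dp \<equiv> (tail G a, d)"

lemma dp_path: "dp \<in> paths G"
  using d_walk by (simp add: mem_paths_iff)

text \<open>\<open>base\<close> counts from the end of \<open>d\<close>, so the enumeration of the
  vertices is reversed.\<close>

lemma path_verts_d: "path_verts G dp = base ` {..length d}"
proof -
  obtain u where u: "awalk (tail G a) d u"
    using d_walk by (auto simp: walks_from_def)
  define vs where "vs = awalk_verts (tail G a) d"
  have len: "length vs = Suc (length d)"
    by (simp add: vs_def length_awalk_verts)
  have b: "base (length d - k) = vs ! k" if "k \<le> length d" for k
  proof -
    have "awalk_verts (tail G a) (take k d) = take (Suc k) vs"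
      unfolding vs_def using u by (intro awalk_verts_take_conv) auto
    then show ?thesis
      using that len by (simp add: base_def take_Suc_conv_app_nth)
  qed
  have "set vs = (\<lambda>k. base (length d - k)) ` {..length d}"
    using b len by (auto simp: set_conv_nth image_iff less_Suc_eq_le)
  also have "\<dots> = base ` (\<lambda>k. length d - k) ` {..length d}"
    by (simp add: image_image)
  also have "(\<lambda>k. length d - k) ` {..length d} = {..length d}"
    by (auto simp: image_iff) (metis atMost_iff diff_diff_cancel diff_le_self)
  finally show ?thesis
    by (simp add: path_verts_def vs_def)
qed

lemma sindex_infinite:
  assumes "other_circuit_attached G a dp"
  shows "sindex (\<S> G) subsemi = \<infinity>"
proof -
  obtain c e g where c: "is_circuit G c" "e \<in> pedges c" "a \<noteq> e"
    and g: "g \<in> paths G" "fst g \<in> path_verts G dp" "pran G g \<in> path_verts G c"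
    using assms unfolding other_circuit_attached_def by blast
  obtain n where n: "fst g = base n"
    using g(2) path_verts_d by auto
  define u where "u = pran G g"
  have gw: "awalk (base n) (snd g) u"
    using g(1) n by (auto simp: mem_paths_iff walks_from_def u_def pran_def)
  have "awalk (fst c) (snd c) (fst c)"
    using c(1) by (auto simp: is_circuit_def mem_paths_iff walks_from_def pran_def)
  then obtain c1 c2 where c12: "snd c = c1 @ c2" "awalk (fst c) c1 u" "awalk u c2 (fst c)"
    using awalk_decomp g(3) unfolding path_verts_def u_def by metis
  \<comment> \<open>The circuit is rotated to start at \<open>u\<close>, where \<open>g\<close>
    ends, so that its powers can follow \<open>g\<close>.\<close>
  define b where "b = c2 @ c1"
  have b: "awalk u b u" "e \<in> set b"
    using c12 c(2) by (auto simp: b_def)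
  define w where "w i = snd g @ concat (replicate i b)" for i
  have "awalk u (concat (replicate i b)) u" for i
    using b(1) by (induction i) (auto simp: awalk_Nil_iff intro: awalk_appendI)
  then have w: "w i \<in> walks_from (base n)" for i
    using awalk_appendI[OF gw] unfolding w_def walks_from_def by blast
  let ?c = "\<lambda>w. length (filter (\<lambda>x. x \<noteq> a) w)"
  have cw: "?c (w i) = ?c (snd g) + i * ?c b" for i
    unfolding w_def by (induction i) simp_all
  have "?c b > 0"
    using b(2) c(3) by (auto simp: filter_empty_conv)
  then have "inj (\<lambda>i. cls (n, w i))"
    using cls_eq_iff[OF w] rel_same_count cw
    by (intro injI) (metis add_left_cancel mult_right_cancel not_gr_zero)
  then have "infinite (range (\<lambda>i. cls (n, w i)))"
    using finite_imageD by blast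
  moreover have "range (\<lambda>i. cls (n, w i)) \<subseteq> cosets (\<S> G) subsemi"
    using w unfolding cosets_eq by auto
  ultimately show ?thesis
    using finite_subset by (auto simp: sindex_def ecard_def)
qed

end

section \<open>Finite index when no other circuit is attached\<close>

locale loop_cycle_unattached = loop_cycle +
  assumes unattached: "\<not> other_circuit_attached G a (tail G a, d)"
begin

lemma circuit_trivial:
  assumes "n \<le> length d" "awalk (base n) g u" "awalk u c u"
  shows "set c \<subseteq> {a}"
proof
  fix e assume e: "e \<in> set c"
  have "u \<in> set (awalk_verts u c)"
    using hd_in_awalk_verts assms(3) by blast
  then show "e \<in> {a}"
    using attached_if_reachable[OF dp_path _ assms(2,3) _ e] unattached path_verts_d assms(1)
    by auto
qed

lemma loop_hd:
  assumes "awalk (tail G a) c (tail G a)" "c \<noteq> []"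
  shows "hd c = a"
proof -
  have "tail G a \<in> verts G"
    using a_arc by simp
  then have "set c \<subseteq> {a}"
    using circuit_trivial[of "length d" "[]" "tail G a" c] assms
    by (simp add: base_ge awalk_Nil_iff)
  then show ?thesis
    using assms(2) hd_in_set by blast
qed

text \<open>A walk using \<open>a\<close> returns to the vertex of the loop. Preceded by the part of
  \<open>d\<close> leading to \<open>base n\<close>, its portion before the first \<open>a\<close>
  is a nonempty closed walk there, not starting with \<open>a\<close>, contrary to
  \<open>loop_hd\<close>.\<close>

lemma not_in_walk:
  assumes "n \<le> length d" "w \<in> walks_from (base n)" "w = [] \<or> n \<noteq> length d \<or> hd w \<noteq> a"
  shows "a \<notin> set w"
proof
  assume "a \<in> set w"
  then obtain w1 w2 where w: "w = w1 @ a # w2" "a \<notin> set w1"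
    by (meson split_list_first)
  have "awalk (base n) w1 (tail G a)"
    using assms(2) unfolding w walks_from_def by (auto simp: awalk_Cons_iff)
  then have c: "awalk (tail G a) (seg n (length d) @ w1) (tail G a)"
    using awalk_seg[OF assms(1)] base_ge[of "length d"] awalk_appendI by fastforce
  show False
  proof (cases "n = length d")
    case True
    then have "w1 \<noteq> []"
      using assms(3) w by auto
    then show False
      using loop_hd[OF c] True w(2) by (auto dest: hd_in_set)
  next
    case False
    then have "seg n (length d) \<noteq> []" "d \<noteq> []"
      using assms(1) length_seg[of n "length d"] by (auto simp del: length_seg)
    then show False
      using loop_hd[OF c] hd_seg[of n "length d"] hd_ne assms(1) False
      by (simp add: suff_eq_drop)
  qed
qed

lemma tail_hd_suff: "n > 0 \<Longrightarrow> tail G (hd (suff n)) = base n"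
  using awalk_suff[of n] length_suff[of n]
  by (cases "suff n") (auto simp: awalk_Cons_iff simp del: length_suff)

text \<open>A repeated vertex makes a part of \<open>d\<close> a circuit, hence a power of
  \<open>a\<close>. If that part starts \<open>d\<close>, this contradicts \<open>hd_ne\<close>;
  otherwise the part of \<open>d\<close> before it is closed at the vertex of the loop and
  contradicts \<open>loop_hd\<close>.\<close>

lemma inj_on_base: "inj_on base {..length d}"
proof -
  have "base i \<noteq> base j" if "i < j" "j \<le> length d" for i j
  proof
    assume eq: "base i = base j"
    have ne: "seg k j \<noteq> []" if "k < j" for k j
      using that length_seg[of k j] by (auto simp del: length_seg)
    have hd_d: "hd (suff (length d)) \<noteq> a"
      using hd_ne that suff_ge[of "length d"] by (cases "d = []") auto
    have "awalk (base j) [] (base j)"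
      using awalk_suff[of j] by (auto simp: awalk_Nil_iff)
    then have "set (seg i j) \<subseteq> {a}"
      using circuit_trivial[OF that(2)] awalk_seg[of i j] eq that(1) by auto
    then have "hd (seg i j) = a"
      using ne[OF that(1)] hd_in_set by blast
    then have hd: "hd (suff j) = a"
      using hd_seg that(1) by metis
    then have j: "j < length d"
      using hd_d that(2) nat_less_le by blast
    have "base j = tail G a"
      using tail_hd_suff[of j] hd that by simp
    then have "awalk (tail G a) (seg j (length d)) (tail G a)"
      using awalk_seg[OF that(2)] base_ge[of "length d"] by simp
    then show False
      using loop_hd ne[OF j] hd_seg[OF j] hd_d by metis
  qed
  then show ?thesis
    by (intro linorder_inj_onI') auto
qed

definition normals :: "nat \<Rightarrow> 'b list set" where
  "normals n = {w \<in> walks_from (base n). normal n w}"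

lemma reps_eq_Sigma: "reps = Sigma {..<length d + m} normals"
  by (auto simp: reps_def normals_def normal_def)

text \<open>Normality restricts only the first edge, by \<open>hd (suff n)\<close> and possibly
  \<open>a\<close>. By \<open>not_in_walk\<close> the edge \<open>a\<close> is then absent
  throughout, and by \<open>inj_on_base\<close> no other edge of \<open>d\<close> starts at
  \<open>base n\<close>.\<close>

lemma normals_le:
  assumes n: "n \<le> length d"
  shows "normals n = {w \<in> walks_from (base n). a \<notin> set w \<and> (w = [] \<or> hd w \<notin> set d)}"
proof (intro equalityI subsetI)
  fix w assume "w \<in> normals n"
  then have w: "w \<in> walks_from (base n)" "w = [] \<or> hd w \<notin> forb n"
    by (auto simp: normals_def normal_def)
  have "a \<notin> set w"
    using w(2) by (intro not_in_walk[OF n w(1)]) (auto simp: forb_def split: if_splits)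
  moreover have "hd w \<notin> set d" if "w \<noteq> []"
  proof
    assume "hd w \<in> set d"
    then obtain k where k: "k < length d" "d ! k = hd w"
      by (auto simp: in_set_conv_nth)
    then have hd: "hd (suff (length d - k)) = hd w"
      by (simp add: suff_eq_drop hd_drop_conv_nth)
    have "tail G (hd w) = base n"
      using w(1) that by (cases w) (auto simp: walks_from_def awalk_Cons_iff)
    then have "base (length d - k) = base n"
      using tail_hd_suff[of "length d - k"] hd k(1) by simp
    then have "n = length d - k"
      using inj_on_base n by (auto simp: inj_on_def)
    then show False
      using w(2) that hd k(1) by (auto simp: forb_def)
  qed
  ultimately show "w \<in> {w \<in> walks_from (base n). a \<notin> set w \<and> (w = [] \<or> hd w \<notin> set d)}"
    using w(1) by blast
next
  fix w assume w: "w \<in> {w \<in> walks_from (base n). a \<notin> set w \<and> (w = [] \<or> hd w \<notin> set d)}"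
  have "hd (suff n) \<in> set d" if "n > 0"
  proof -
    have "suff n \<noteq> []"
      using that length_suff[of n] by (auto simp del: length_suff)
    then show ?thesis
      using n hd_in_set in_set_dropD by (metis suff_eq_drop)
  qed
  then show "w \<in> normals n"
    using w n m_pos by (auto simp: normals_def normal_def forb_def dest: hd_in_set)
qed

lemma normals_gt:
  assumes "length d < n" "n < length d + m"
  shows "normals n = {w \<in> walks_from (tail G a). w = [] \<or> hd w \<noteq> a}"
  using assms by (auto simp: normals_def normal_def forb_def hd_suff base_ge)

lemma finite_avoiding:
  assumes n: "n \<le> length d"
  shows "finite {w \<in> walks_from (base n). a \<notin> set w}"
proof (rule finite_walks_from_if_acyclic[OF fin_digraph_axioms, of _ "base n"])
  fix p c u w
  assume w: "p @ c @ w \<in> {w \<in> walks_from (base n). a \<notin> set w}" "awalk (base n) p u" "awalk u c u"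
  then have "set c \<subseteq> {a}" "a \<notin> set c"
    using circuit_trivial[OF n] by auto
  then show "c = []"
    by (cases c) simp_all
qed blast

lemma finite_normals: "n \<le> length d \<Longrightarrow> finite (normals n)"
  using finite_avoiding[of n] by (rule rev_finite_subset) (auto simp: normals_le)

lemma finite_not_loop: "finite {w \<in> walks_from (tail G a). w = [] \<or> hd w \<noteq> a}"
  using finite_avoiding[of "length d"]
  by (rule rev_finite_subset) (use not_in_walk[of "length d"] base_ge[of "length d"] in auto)

lemma num_paths_loop:
  "num_paths G (tail G a) (arc_path G a) =
    enat (card {w \<in> walks_from (tail G a). w = [] \<or> hd w \<noteq> a})"
  using finite_not_loop by (simp add: num_paths_eq arc_path_def ecard_def)

lemma num_paths_normals:
  assumes "n \<le> length d"
  shows "num_paths (del_arc a) (base n) dp = enat (card (normals n))"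
proof -
  have "num_paths (del_arc a) (base n) dp = ecard (normals n)"
    unfolding wf_digraph.num_paths_eq[OF wf_digraph_del_arc] walks_from_del_arc
    using assms by (simp add: normals_le conj_assoc)
  then show ?thesis
    using finite_normals[OF assms] by (simp add: ecard_def)
qed

lemma sindex_formula:
  "sindex (\<S> G) subsemi \<noteq> \<infinity> \<and>
   sindex (\<S> G) subsemi = enat (m - 1) * num_paths G (tail G a) (arc_path G a) +
     (\<Sum>v\<in>path_verts G dp. num_paths (del_arc a) v dp)"
proof -
  let ?A = "{w \<in> walks_from (tail G a). w = [] \<or> hd w \<noteq> a}"
  have split: "{..<length d + m} = {..length d} \<union> {length d<..<length d + m}"
    using m_pos by auto
  have fin: "finite (normals n)" if "n < length d + m" for n
    using that finite_normals[of n] finite_not_loop normals_gt[of n] by (cases "n \<le> length d") auto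
  have "card reps = (\<Sum>n<length d + m. card (normals n))"
    unfolding reps_eq_Sigma using fin by simp
  also have "\<dots> = (\<Sum>n\<le>length d. card (normals n)) +
      (\<Sum>n\<in>{length d<..<length d + m}. card (normals n))"
    unfolding split by (rule sum.union_disjoint) auto
  also have "(\<Sum>n\<in>{length d<..<length d + m}. card (normals n)) = (m - 1) * card ?A"
    by (simp add: normals_gt)
  finally have "card reps = (m - 1) * card ?A + (\<Sum>n\<le>length d. card (normals n))"
    by simp
  moreover have "(\<Sum>v\<in>path_verts G dp. num_paths (del_arc a) v dp) =
      enat (\<Sum>n\<le>length d. card (normals n))"
    \<comment> \<open>Injectivity of \<open>base\<close> turns the sum over vertices, each counted
      once, into a sum over lengths.\<close>
    unfolding path_verts_d sum.reindex[OF inj_on_base]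
    by (simp add: num_paths_normals flip: of_nat_eq_enat)
  moreover have "finite reps"
    unfolding reps_eq_Sigma using fin by (intro finite_SigmaI) auto
  ultimately show ?thesis
    by (simp add: sindex_eq_ecard_reps ecard_def num_paths_loop)
qed

end

theorem theorem4p4:
  fixes G :: "('a, 'b) pre_digraph" and a :: 'b and m :: nat and d :: "('a, 'b) dpath"
  assumes "fin_digraph G"
    and "a \<in> arcs G"
    and "is_circuit G (arc_path G a)"
    and "m \<ge> 1"
    and "cycle_type_pair G (ppow (arc_path G a) m) d"
  defines "L \<equiv> cycle_type G (ppow (arc_path G a) m) d"
  shows "(other_circuit_attached G a d \<longrightarrow> sindex (\<S> G) L = \<infinity>) \<and>
         (\<not> other_circuit_attached G a d \<longrightarrow>
            sindex (\<S> G) L \<noteq> \<infinity> \<and>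
            sindex (\<S> G) L =
              enat (m - 1) * num_paths G (tail G a) (arc_path G a) +
              (\<Sum>v\<in>path_verts G d. num_paths (pre_digraph.del_arc G a) v d))"
proof -
  interpret fin_digraph G by fact
  obtain D where d: "d = (tail G a, D)"
    using assms(5) by (cases d) (simp add: cycle_type_pair_def ppow_def arc_path_def)
  have head_a: "head G a = tail G a"
    using assms(3) by (simp add: is_circuit_def arc_path_def pran_def)
  have D: "D \<in> walks_from (tail G a)"
  proof -
    have "d \<in> paths G"
      using assms(5) unfolding cycle_type_pair_def by blast
    then show ?thesis
      by (simp add: d mem_paths_iff)
  qed
  \<comment> \<open>Otherwise, as \<open>m \<ge> 1\<close>, the path consisting of \<open>a\<close>
    alone would be a common prefix of the circuit and \<open>d\<close>.\<close>
  have hd_D: "hd D \<noteq> a" if ne: "D \<noteq> []"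
  proof
    assume "hd D = a"
    then obtain D' where D': "D = a # D'"
      using ne by (cases D) auto
    obtain m' where m': "m = Suc m'"
      using assms(4) by (cases m) auto
    have "ppow (arc_path G a) m \<in> paths G"
      using assms(5) by (simp add: cycle_type_pair_def is_circuit_def)
    then have "pprefix G (tail G a, [a]) (ppow (arc_path G a) m)"
      unfolding pprefix_def is_decomp_iff
      by (intro exI[of _ "(tail G a, replicate m' a)"])
        (simp add: ppow_def arc_path_def m' head_a concat_replicate_single)
    moreover have "pprefix G (tail G a, [a]) d"
      unfolding pprefix_def is_decomp_iff
      using D by (intro exI[of _ "(tail G a, D')"]) (simp add: d D' head_a mem_paths_iff)
    ultimately show False
      using assms(5) by (auto simp: cycle_type_pair_def)
  qed
  then interpret loop_cycle G a m D
    using assms(2,4) head_a D hd_D by unfold_locales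
  have L: "L = loop_cycle.subsemi G a m D"
    unfolding assms(6) d by (rule cycle_type_eq_subsemi)
  show ?thesis
  proof (cases "other_circuit_attached G a d")
    case True
    then show ?thesis
      using sindex_infinite unfolding L d by simp
  next
    case False
    then interpret loop_cycle_unattached G a m D
      by unfold_locales (simp add: d)
    show ?thesis
      using False sindex_formula unfolding L d by blast
  qed
qed

end
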